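(* The following two assertions are equivalent. (A) For all coprime integers $p>q\ge 1$: for every $u\in\mathcal{L}_{p/q}$, the infinite word $\mathtt{wmax}_{p/q}(u)$ is normal over the alphabet $\{p-q,\dots,p-1\}$; and for every $u\in\mathcal{L}_{p/q}$ with $u\ne\epsilon$, the infinite word $\mathtt{wmin}_{p/q}(u)$ is normal over the alphabet $\{0,\dots,q-1\}$. (B) For all coprime integers $p>q\ge 1$, every integer $n\ge 1$ and every integer $k\ge 0$, the integer sequence $(T_{p/q}^l(n))_{l\in\mathbb{N}}$ of iterates of the operator $T_{p/q}(x)=\left\lceil \frac pq x\right\rceil$ is equidistributed in the residue classes modulo $q^k$.
   Context: Here $\mathbb{N}=\{0,1,2,\dots\}$. Rational base expansions. Let $p>q\ge 1$ be coprime integers. The expansion $\mathtt{rep}_{p/q}(n)$ of $n\in\mathbb{N}$ in base $p/q$ is the unique finite word $a_ka_{k-1}\cdots a_0$ over $\{0,\dots,p-1\}$ not starting with the letter $0$ and such that $n=\frac1q\sum_{i=0}^k a_i\left(\frac pq\right)^i$ (the expansion of $0$ is the empty word $\epsilon$). Put $\mathcal{L}_{p/q}=\{\mathtt{rep}_{p/q}(n): n\in\mathbb{N}\}$. This language is prefix-closed, and every word of it can be extended on the right by some letter of $\{0,\dots,p-1\}$ to a word of $\mathcal{L}_{p/q}$. Minimal and maximal words. For $u\in\mathcal{L}_{p/q}$, the minimal (resp. maximal) word with seed $u$, denoted $\mathtt{wmin}_{p/q}(u)$ (resp. $\mathtt{wmax}_{p/q}(u)$), is the unique infinite word such that, for every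 $l\in\mathbb{N}$, its prefix of length $l$ is the lexicographically smallest (resp. largest) word $v\in\{0,\dots,p-1\}^l$ such that the concatenation $uv$ belongs to $\mathcal{L}_{p/q}$. (Equivalently, it is built letter by letter, starting from $u$, by always appending the smallest (resp. largest) letter keeping the word in $\mathcal{L}_{p/q}$.) Normality. An infinite word $w=w_0w_1w_2\cdots$ over an alphabet $A$ with $d$ letters is normal over $A$ if for every $l\ge 1$ and every $v\in A^l$, $\lim_{N\to\infty}\frac1N\,\mathrm{Card}\{0\le m<N : w_m\cdots w_{m+l-1}=v\}=\frac{1}{d^l}$. Equidistribution. An integer sequence $(u_n)_{n\in\mathbb{N}}$ is equidistributed in the residue classes modulo $m$ if for every $r\in\{0,\dots,m-1\}$, $\lim_{N\to\infty}\frac1N\,\mathrm{Card}\{0\le n<N : u_n\equiv r \bmod m\}=\frac1m$. *)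

theory Defs
  imports
    "HOL-Analysis.Analysis"
    "HOL-Library.Omega_Words_Fun"
    "HOL-Number_Theory.Cong"
begin

text \<open>
  Finite words over the digits \<open>{0..<p}\<close> are lists of naturals with the most significant digit
  first, so that the digit \<open>a\<^sub>i\<close> of \<open>w = a\<^sub>k \<dots> a\<^sub>0\<close> is \<open>rev w ! i\<close>. Infinite words are the
  functions of type \<^typ>\<open>'a word\<close> from \<^theory>\<open>HOL-Library.Omega_Words_Fun\<close>.
\<close>

definition val_pq :: "nat \<Rightarrow> nat \<Rightarrow> nat list \<Rightarrow> real" where
  "val_pq p q w = 1 / real q * (\<Sum>i<length w. real (rev w ! i) * (real p / real q) ^ i)"

text \<open>
  The definite descriptions below denote what they should only for coprime \<open>p > q \<ge> 1\<close>
  (and, for \<open>wmin_pq\<close> and \<open>wmax_pq\<close>, seeds \<open>u \<in> lang_pq p q\<close>).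
\<close>

definition rep_pq :: "nat \<Rightarrow> nat \<Rightarrow> nat \<Rightarrow> nat list" where
  "rep_pq p q n =
    (THE w. set w \<subseteq> {0..<p} \<and> (w \<noteq> [] \<longrightarrow> hd w \<noteq> 0) \<and> real n = val_pq p q w)"

definition lang_pq :: "nat \<Rightarrow> nat \<Rightarrow> nat list set" where
  "lang_pq p q = {rep_pq p q n | n. True}"

definition right_extensions :: "nat \<Rightarrow> nat \<Rightarrow> nat list \<Rightarrow> nat \<Rightarrow> nat list set" where
  "right_extensions p q u l = {v. length v = l \<and> set v \<subseteq> {0..<p} \<and> u @ v \<in> lang_pq p q}"

definition lex_smallest :: "'a::linorder list set \<Rightarrow> 'a list \<Rightarrow> bool" where
  "lex_smallest V v \<longleftrightarrow> v \<in> V \<and> (\<forall>v'\<in>V. lexordp_eq v v')"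

definition lex_largest :: "'a::linorder list set \<Rightarrow> 'a list \<Rightarrow> bool" where
  "lex_largest V v \<longleftrightarrow> v \<in> V \<and> (\<forall>v'\<in>V. lexordp_eq v' v)"

definition wmin_pq :: "nat \<Rightarrow> nat \<Rightarrow> nat list \<Rightarrow> nat word" where
  "wmin_pq p q u = (THE w. \<forall>l. lex_smallest (right_extensions p q u l) (prefix l w))"

definition wmax_pq :: "nat \<Rightarrow> nat \<Rightarrow> nat list \<Rightarrow> nat word" where
  "wmax_pq p q u = (THE w. \<forall>l. lex_largest (right_extensions p q u l) (prefix l w))"

text \<open>
  Normality over \<open>A\<close> includes that \<open>w\<close> is a word over \<open>A\<close>; \<open>A\<close> is meant to be finite.
  The factor \<open>w\<^sub>m \<dots> w\<^bsub>m+l-1\<^esub>\<close> is \<open>w [m \<rightarrow> m + l]\<close>.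
\<close>

definition normal_word :: "'a set \<Rightarrow> 'a word \<Rightarrow> bool" where
  "normal_word A w \<longleftrightarrow> range w \<subseteq> A \<and>
    (\<forall>l\<ge>1. \<forall>v. length v = l \<and> set v \<subseteq> A \<longrightarrow>
      (\<lambda>N. real (card {m. m < N \<and> w [m \<rightarrow> m + l] = v}) / real N)
        \<longlonglongrightarrow> 1 / real (card A) ^ l)"

definition equidistributed_mod :: "(nat \<Rightarrow> int) \<Rightarrow> nat \<Rightarrow> bool" where
  "equidistributed_mod u m \<longleftrightarrow>
    (\<forall>r\<in>{0..<int m}.
      (\<lambda>N. real (card {n. n < N \<and> [u n = r] (mod int m)}) / real N) \<longlonglongrightarrow> 1 / real m)"

definition T_pq :: "nat \<Rightarrow> nat \<Rightarrow> int \<Rightarrow> int" where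
  "T_pq p q x = \<lceil>real p / real q * real_of_int x\<rceil>"

end

theory Submission
  imports Defs
begin

text \<open>
  Both assertions speak about one object: the sequence of remainders produced along a \<open>T\<close>-orbit.
  Up to the ban on a leading zero, a digit \<open>a\<close> may follow the expansion of \<open>n\<close> exactly when \<open>q\<close>
  divides \<open>p n + a\<close>, and the result is the expansion of \<open>(p n + a) / q\<close>. Write
  \<open>d x = (- p x) mod q\<close>, so that \<open>q T x = p x + d x\<close>. The least possible digit after \<open>n \<ge> 1\<close> is
  \<open>d n\<close> and leads to \<open>T n\<close>; the greatest possible digit after \<open>n \<ge> 0\<close> is
  \<open>d (n + 1) + (p - q)\<close> and leads to \<open>T (n + 1) - 1\<close>. Hence the minimal word with a seed of
  value \<open>n \<ge> 1\<close> is the sequence of \<open>d\<close>-values along the \<open>T\<close>-orbit of \<open>n\<close>, and the maximal word is,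
  up to a shift of the alphabet by \<open>p - q\<close>, the same sequence along the orbit of \<open>n + 1\<close>
  (\<open>wmin_eq\<close>, \<open>wmax_eq\<close>).

  The first \<open>k\<close> values of \<open>d\<close> along the orbit of \<open>x\<close> determine, and are determined by, the residue
  of \<open>x\<close> modulo \<open>q ^ k\<close> (\<open>prefix_remainders_eq_iff\<close>); as there are as many residues as words,
  every word over \<open>{0..<q}\<close> occurs (\<open>ex_residue_of_word\<close>). Occurrences of a word of length \<open>k\<close> in
  the remainder sequence are therefore the times at which the orbit visits one
  residue class modulo \<open>q ^ k\<close>, so that normality and equidistribution count the same sets. Every
  \<open>n \<ge> 1\<close> is the value of a nonempty seed, so minimal words see all orbits.
\<close>

section \<open>Relabelling the alphabet of a normal word\<close>

lemma normal_word_relabel: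
  assumes "normal_word A w" and "inj f"
  shows "normal_word (f ` A) (f \<circ> w)"
  unfolding normal_word_def
proof (intro conjI allI impI)
  show "range (f \<circ> w) \<subseteq> f ` A"
    using assms(1) by (auto simp: normal_word_def)
next
  fix l :: nat and v
  assume l: "1 \<le> l" and v: "length v = l \<and> set v \<subseteq> f ` A"
  define v' where "v' = map (inv f) v"
  have v_eq: "v = map f v'"
    using v unfolding v'_def map_map by (intro map_idI[symmetric]) (auto simp: f_inv_into_f)
  have v': "length v' = l \<and> set v' \<subseteq> A"
    using v \<open>inj f\<close> unfolding v'_def by (auto simp: inv_f_f)
  have "(f \<circ> w) [m \<rightarrow> m + l] = v \<longleftrightarrow> w [m \<rightarrow> m + l] = v'" for m
    unfolding v_eq subsequence_def map_map[symmetric]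
    using \<open>inj f\<close> by (simp only: inj_map_eq_map)
  moreover have "card (f ` A) = card A"
    using \<open>inj f\<close> by (simp add: card_image inj_on_subset)
  ultimately show "(\<lambda>N. real (card {m. m < N \<and> (f \<circ> w) [m \<rightarrow> m + l] = v}) / real N)
      \<longlonglongrightarrow> 1 / real (card (f ` A)) ^ l"
    using assms(1) l v' unfolding normal_word_def by simp
qed

section \<open>Words given by their lexicographically extreme prefixes\<close>

lemma word_eqI_prefix:
  assumes "\<And>l. prefix l w = prefix l w'"
  shows "w = w'"
proof
  fix i
  have "prefix (Suc i) w ! i = prefix (Suc i) w' ! i"
    by (simp only: assms)
  then show "w i = w' i"
    by (simp add: nth_append)
qed

lemma The_lex_smallest_prefix:
  assumes "\<And>l. lex_smallest (V l) (prefix l w)"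
  shows "(THE w. \<forall>l. lex_smallest (V l) (prefix l w)) = w"
  using assms
  by (intro the_equality word_eqI_prefix) (auto simp: lex_smallest_def intro: lexordp_eq_antisym)

lemma The_lex_largest_prefix:
  assumes "\<And>l. lex_largest (V l) (prefix l w)"
  shows "(THE w. \<forall>l. lex_largest (V l) (prefix l w)) = w"
  using assms
  by (intro the_equality word_eqI_prefix) (auto simp: lex_largest_def intro: lexordp_eq_antisym)

lemma prefix_Suc_Cons: "prefix (Suc l) w = w 0 # prefix l (\<lambda>i. w (Suc i))"
  unfolding subsequence_def by (simp add: upt_conv_Cons map_Suc_upt[symmetric] del: upt_Suc)

locale rational_base =
  fixes p q :: nat
  assumes q_pos: "1 \<le> q" and q_less_p: "q < p" and coprime_p_q: "coprime p q"
begin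

section \<open>Expansions of natural numbers\<close>

lemma val_Nil: "val_pq p q [] = 0"
  by (simp add: val_pq_def)

lemma val_snoc: "real q * val_pq p q (w @ [a]) = real p * val_pq p q w + real a"
proof -
  have "(\<Sum>i<length w. real (rev w ! i) * (real p / real q) ^ Suc i)
      = real p / real q * (\<Sum>i<length w. real (rev w ! i) * (real p / real q) ^ i)"
    by (simp add: sum_distrib_left mult_ac)
  then show ?thesis
    using q_pos unfolding val_pq_def
    by (simp add: sum.lessThan_Suc_shift field_simps del: sum.lessThan_Suc power_Suc)
qed

lemma val_denominator: "\<exists>M::nat. val_pq p q w * real q ^ length w = real M"
proof (induction w rule: rev_induct)
  case Nil
  show ?case by (auto simp: val_Nil intro: exI[of _ 0])
next
  case (snoc a w)
  then obtain M where M: "val_pq p q w * real q ^ length w = real M" ..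
  have "val_pq p q (w @ [a]) * real q ^ length (w @ [a])
      = real q * val_pq p q (w @ [a]) * real q ^ length w"
    by simp
  also have "\<dots> = real p * (val_pq p q w * real q ^ length w) + real a * real q ^ length w"
    unfolding val_snoc by (simp add: algebra_simps)
  also have "\<dots> = real (p * M + a * q ^ length w)"
    by (simp add: M)
  finally show ?case ..
qed

text \<open>
  The denominator of the value of \<open>w\<close> is a power of \<open>q\<close>, and multiplication by \<open>p\<close>, which is
  coprime to it, cannot cancel any part of it.
\<close>

lemma val_init_integral:
  assumes "val_pq p q (w @ [a]) = real n"
  obtains m :: nat where "val_pq p q w = real m"
proof -
  obtain M :: nat where M: "val_pq p q w * real q ^ length w = real M"
    using val_denominator by blast
  have "real (q * n * q ^ length w) = (real p * val_pq p q w + real a) * real q ^ length w"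
    unfolding val_snoc[symmetric] assms by simp
  also have "\<dots> = real (p * M + a * q ^ length w)"
    by (simp add: M[symmetric] algebra_simps)
  finally have "p * M + a * q ^ length w = q * n * q ^ length w"
    by (simp only: of_nat_eq_iff)
  then have "q ^ length w dvd p * M + a * q ^ length w"
    by simp
  then have "q ^ length w dvd p * M"
    by (simp add: dvd_add_left_iff)
  then have "q ^ length w dvd M"
    using coprime_p_q by (subst (asm) coprime_dvd_mult_right_iff) (simp_all add: coprime_commute)
  then obtain m where "M = q ^ length w * m" ..
  with M q_pos have "val_pq p q w = real m"
    by simp
  then show thesis ..
qed

text \<open>
  The characterisation of \<open>rep_pq p q n\<close> as a relation, so that it can be unfolded digit by digit
  before the existence and uniqueness of the expansion are known.
\<close>

definition expands :: "nat \<Rightarrow> nat list \<Rightarrow> bool" where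
  "expands n w \<longleftrightarrow> set w \<subseteq> {0..<p} \<and> (w \<noteq> [] \<longrightarrow> hd w \<noteq> 0) \<and> real n = val_pq p q w"

lemma expands_Nil: "expands n [] \<longleftrightarrow> n = 0"
  by (simp add: expands_def val_Nil)

lemma expands_snoc:
  "expands n (w @ [a]) \<longleftrightarrow> a < p \<and> (w = [] \<longrightarrow> a \<noteq> 0) \<and> (\<exists>m. expands m w \<and> q * n = p * m + a)"
proof -
  have step: "real n = val_pq p q (w @ [a]) \<longleftrightarrow> q * n = p * m + a"
    if "real m = val_pq p q w" for m
  proof -
    have "real n = val_pq p q (w @ [a]) \<longleftrightarrow> real q * real n = real q * val_pq p q (w @ [a])"
      using q_pos by simp
    also have "\<dots> \<longleftrightarrow> real (q * n) = real (p * m + a)"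
      unfolding val_snoc by (simp add: that)
    finally show ?thesis
      by (simp only: of_nat_eq_iff)
  qed
  have "\<exists>m. real m = val_pq p q w" if "real n = val_pq p q (w @ [a])"
    using val_init_integral[OF that[symmetric]] by metis
  with step show ?thesis
    unfolding expands_def by (cases "w = []") auto
qed

lemma expands_0D: "expands 0 w \<Longrightarrow> w = []"
proof (induction w rule: rev_induct)
  case (snoc a w)
  then show ?case
    using q_less_p by (auto simp: expands_snoc)
qed simp

lemma expands_unique: "expands n w \<Longrightarrow> expands n w' \<Longrightarrow> w = w'"
proof (induction w arbitrary: n w' rule: rev_induct)
  case Nil
  then show ?case
    using expands_0D by (metis expands_Nil)
next
  case (snoc a w)
  show ?case
  proof (cases w' rule: rev_cases)
    case Nil
    then show ?thesis
      using snoc.prems expands_0D by (metis expands_Nil)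
  next
    case (snoc w'' b)
    obtain m m' where m: "a < p" "expands m w" "q * n = p * m + a"
      and m': "b < p" "expands m' w''" "q * n = p * m' + b"
      using snoc.prems unfolding snoc expands_snoc by auto
    have "a = b"
      using m m' by (metis mod_less mod_mult_self4)
    moreover have "m = m'"
      using m m' \<open>a = b\<close> q_less_p by auto
    ultimately show ?thesis
      using snoc.IH m(2) m'(2) snoc by simp
  qed
qed

text \<open>
  Digits are produced from the least significant end: \<open>q n\<close> is divided by \<open>p\<close>, and the quotient is
  smaller than \<open>n\<close> because \<open>q < p\<close>.
\<close>

lemma expands_exists: "\<exists>w. expands n w"
proof (induction n rule: less_induct)
  case (less n)
  show ?case
  proof (cases "n = 0")
    case True
    then show ?thesis
      using expands_Nil by blast
  next
    case False
    let ?m = "q * n div p" and ?a = "q * n mod p"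
    have "?m < n"
      using False q_less_p by (simp add: less_mult_imp_div_less mult.commute)
    then obtain w where w: "expands ?m w"
      using less.IH by blast
    have "w = [] \<longrightarrow> ?a \<noteq> 0"
    proof
      assume "w = []"
      then have "?m = 0"
        using w expands_Nil by blast
      then have "?a = q * n"
        by (metis add_0 div_mult_mod_eq mult_zero_left)
      then show "?a \<noteq> 0"
        using False q_pos by simp
    qed
    then have "expands n (w @ [?a])"
      using w q_less_p unfolding expands_snoc by (auto intro!: exI[of _ ?m])
    then show ?thesis ..
  qed
qed

lemma rep_eq: "expands n w \<Longrightarrow> rep_pq p q n = w"
  unfolding rep_pq_def expands_def[symmetric]
  by (rule the_equality) (auto intro: expands_unique)

lemma lang_iff: "w \<in> lang_pq p q \<longleftrightarrow> (\<exists>n. expands n w)"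
  unfolding lang_pq_def using expands_exists rep_eq by fastforce

lemma snoc_in_langD:
  assumes "expands n u" "u @ [a] \<in> lang_pq p q"
  shows "a < p" and "q dvd p * n + a"
proof -
  obtain n' m where "a < p" "expands m u" "q * n' = p * m + a"
    using assms(2) unfolding lang_iff expands_snoc by blast
  moreover from this(2) assms(1) have "m = n"
    by (simp add: expands_def flip: of_nat_eq_iff)
  ultimately show "a < p" and "q dvd p * n + a"
    by (metis, metis dvd_triv_left)
qed

lemma lang_prefix_closed: "u @ v \<in> lang_pq p q \<Longrightarrow> u \<in> lang_pq p q"
  by (induction v rule: rev_induct) (auto simp: lang_iff expands_snoc simp flip: append_assoc)

lemma right_extensions_Cons:
  "a # v \<in> right_extensions p q u (Suc l) \<longleftrightarrow> a < p \<and> v \<in> right_extensions p q (u @ [a]) l"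
  by (auto simp: right_extensions_def)

section \<open>Remainders along orbits of the ceiling map\<close>

definition remainder :: "int \<Rightarrow> nat" where
  "remainder x = nat ((- (int p * x)) mod int q)"

definition remainders :: "int \<Rightarrow> nat word" where
  "remainders x = (\<lambda>i. remainder ((T_pq p q ^^ i) x))"

lemma remainder_less: "remainder x < q"
  using q_pos by (simp add: remainder_def nat_less_iff)

lemma q_times_T: "int q * T_pq p q x = int p * x + int (remainder x)"
proof -
  have "T_pq p q x = \<lceil>real_of_int (int p * x) / real_of_int (int q)\<rceil>"
    by (simp add: T_pq_def)
  then have "T_pq p q x = - (- (int p * x) div int q)"
    by (simp only: ceiling_divide_eq_div)
  moreover have "int (remainder x) = - (int p * x) mod int q"
    using q_pos by (simp add: remainder_def)
  moreover have "int q * (- (int p * x) div int q) + - (int p * x) mod int q = - (int p * x)"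
    by (rule mult_div_mod_eq)
  ultimately show ?thesis
    by (simp only: mult_minus_right)
qed

lemma T_pos:
  assumes "1 \<le> x"
  shows "1 \<le> T_pq p q x"
proof -
  have "0 < int p * x"
    using assms q_less_p by simp
  then have "0 < int q * T_pq p q x"
    unfolding q_times_T by linarith
  then show ?thesis
    by (simp add: zero_less_mult_iff)
qed

lemma remainders_0: "remainders x 0 = remainder x"
  by (simp add: remainders_def)

lemma remainders_Suc: "(\<lambda>i. remainders x (Suc i)) = remainders (T_pq p q x)"
  by (simp add: remainders_def funpow_Suc_right del: funpow.simps)

lemma prefix_remainders_Suc:
  "prefix (Suc l) (remainders x) = remainder x # prefix l (remainders (T_pq p q x))"
  by (simp only: prefix_Suc_Cons remainders_0 remainders_Suc)

lemma factor_remainders: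
  "(remainders x) [m \<rightarrow> m + l] = prefix l (remainders ((T_pq p q ^^ m) x))"
  by (rule nth_equalityI) (simp_all add: remainders_def add.commute[of m] funpow_add)

lemma remainder_eq_iff: "remainder x = remainder y \<longleftrightarrow> [x = y] (mod int q)"
proof -
  have "remainder x = remainder y \<longleftrightarrow> [- (int p * x) = - (int p * y)] (mod int q)"
    using q_pos by (simp add: remainder_def cong_def eq_nat_nat_iff)
  also have "\<dots> \<longleftrightarrow> [int p * x = int p * y] (mod int q)"
    by (rule cong_minus_minus_iff)
  also have "\<dots> \<longleftrightarrow> [x = y] (mod int q)"
    using coprime_p_q by (simp add: cong_mult_lcancel)
  finally show ?thesis .
qed

text \<open>
  If the first remainders of \<open>x\<close> and \<open>y\<close> agree, then \<open>q (T x - T y) = p (x - y)\<close>, so \<open>T\<close> lowers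
  the power of \<open>q\<close> dividing the difference by exactly one.
\<close>

lemma prefix_remainders_eq_iff:
  "prefix k (remainders x) = prefix k (remainders y) \<longleftrightarrow> [x = y] (mod int q ^ k)"
proof (induction k arbitrary: x y)
  case 0
  show ?case by simp
next
  case (Suc k)
  have "[x = y] (mod int q ^ Suc k) \<longleftrightarrow> [T_pq p q x = T_pq p q y] (mod int q ^ k)"
    if "remainder x = remainder y"
  proof -
    have diff: "int q * (T_pq p q x - T_pq p q y) = int p * (x - y)"
      using that by (simp add: right_diff_distrib q_times_T)
    have "[x = y] (mod int q ^ Suc k) \<longleftrightarrow> int q ^ Suc k dvd int p * (x - y)"
      using coprime_p_q
      by (simp add: cong_iff_dvd_diff coprime_dvd_mult_right_iff coprime_commute del: power_Suc)
    also have "\<dots> \<longleftrightarrow> [T_pq p q x = T_pq p q y] (mod int q ^ k)"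
      unfolding diff[symmetric] using q_pos by (simp add: cong_iff_dvd_diff)
    finally show ?thesis .
  qed
  moreover have "remainder x = remainder y" if "[x = y] (mod int q ^ Suc k)"
    using that remainder_eq_iff by (auto intro: cong_dvd_modulus)
  ultimately show ?case
    unfolding prefix_remainders_Suc using Suc.IH by auto
qed

text \<open>
  By \<open>prefix_remainders_eq_iff\<close> the \<open>q ^ k\<close> residues have distinct remainder words of length \<open>k\<close>;
  since only \<open>q ^ k\<close> words over \<open>{0..<q}\<close> have this length, all of them are reached.
\<close>

lemma ex_residue_of_word:
  assumes "length v = k" "set v \<subseteq> {0..<q}"
  obtains r where "r \<in> {0..<int q ^ k}" "prefix k (remainders r) = v"
proof -
  let ?f = "\<lambda>r. prefix k (remainders r)"
  let ?W = "{v. set v \<subseteq> {0..<q} \<and> length v = k}"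
  have "inj_on ?f {0..<int q ^ k}"
    unfolding inj_on_def prefix_remainders_eq_iff by (auto intro: cong_less_imp_eq_int)
  then have "card (?f ` {0..<int q ^ k}) = q ^ k"
    by (simp add: card_image nat_power_eq)
  also have "\<dots> = card ?W"
    by (simp add: card_lists_length_eq)
  finally have "card (?f ` {0..<int q ^ k}) = card ?W" .
  moreover have "?f ` {0..<int q ^ k} \<subseteq> ?W"
    using remainder_less by (auto simp: remainders_def subsequence_def)
  ultimately have "?f ` {0..<int q ^ k} = ?W"
    by (intro card_subset_eq) (simp_all add: finite_lists_length_eq)
  then have "v \<in> ?f ` {0..<int q ^ k}"
    using assms by simp
  then show thesis
    using that by auto
qed

lemma occurrences_eq_visits:
  "{m. m < N \<and> (remainders x) [m \<rightarrow> m + k] = prefix k (remainders r)}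
     = {m. m < N \<and> [(T_pq p q ^^ m) x = r] (mod int (q ^ k))}"
  by (simp add: factor_remainders prefix_remainders_eq_iff)

lemma normal_remainders_iff:
  "normal_word {0..q - 1} (remainders x)
     \<longleftrightarrow> (\<forall>k. equidistributed_mod (\<lambda>l. (T_pq p q ^^ l) x) (q ^ k))"
proof -
  have alphabet: "{0..q - 1} = {0..<q}"
    using q_pos by auto
  have range: "range (remainders x) \<subseteq> {0..<q}" for x
    using remainder_less by (auto simp: remainders_def)
  show ?thesis
  proof (intro iffI allI)
    fix k
    assume normal: "normal_word {0..q - 1} (remainders x)"
    show "equidistributed_mod (\<lambda>l. (T_pq p q ^^ l) x) (q ^ k)"
    proof (cases "k = 0")
      case True
      \<comment> \<open>Normality is silent about the empty word, but modulo \<open>1\<close> every time is a visit. The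
        quotient \<open>N / N\<close> is \<open>1\<close> only from \<open>N = 1\<close> on, as \<open>0 / 0 = 0\<close>.\<close>
      have "(\<lambda>N::nat. real N / real N) \<longlonglongrightarrow> 1"
        by (rule tendsto_eventually) (auto intro: eventually_sequentiallyI[of 1])
      then show ?thesis
        by (simp add: True equidistributed_mod_def)
    next
      case False
      show ?thesis
        unfolding equidistributed_mod_def occurrences_eq_visits[symmetric]
      proof
        fix r
        have "set (prefix k (remainders r)) \<subseteq> {0..<q}"
          using range[of r] by (auto simp: subsequence_def)
        then show "(\<lambda>N. real (card {n. n < N \<and> (remainders x) [n \<rightarrow> n + k]
            = prefix k (remainders r)}) / real N) \<longlonglongrightarrow> 1 / real (q ^ k)"
          using normal False unfolding normal_word_def alphabet by simp
      qed
    qed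
  next
    assume equi: "\<forall>k. equidistributed_mod (\<lambda>l. (T_pq p q ^^ l) x) (q ^ k)"
    show "normal_word {0..q - 1} (remainders x)"
      unfolding normal_word_def alphabet
    proof (intro conjI allI impI)
      fix k :: nat and v
      assume "length v = k \<and> set v \<subseteq> {0..<q}"
      then obtain r where r: "r \<in> {0..<int q ^ k}" and v: "prefix k (remainders r) = v"
        using ex_residue_of_word by blast
      show "(\<lambda>N. real (card {m. m < N \<and> (remainders x) [m \<rightarrow> m + k] = v}) / real N)
          \<longlonglongrightarrow> 1 / real (card {0..<q}) ^ k"
        using equi r unfolding v[symmetric] occurrences_eq_visits equidistributed_mod_def by simp
    qed (rule range)
  qed
qed

section \<open>Minimal and maximal words\<close>

lemma expands_snoc_min:
  assumes "expands n u" "1 \<le> n"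
  shows "expands (nat (T_pq p q (int n))) (u @ [remainder (int n)])"
proof -
  have "int (q * nat (T_pq p q (int n))) = int (p * n + remainder (int n))"
    using T_pos[of "int n"] assms(2) by (simp add: q_times_T)
  then have "q * nat (T_pq p q (int n)) = p * n + remainder (int n)"
    by (simp only: of_nat_eq_iff)
  moreover have "u \<noteq> []"
    using assms by (metis expands_Nil not_one_le_zero)
  moreover have "remainder (int n) < p"
    using remainder_less q_less_p by (rule less_trans)
  ultimately show ?thesis
    using assms(1) unfolding expands_snoc by blast
qed

lemma expands_snoc_max:
  assumes "expands n u"
  shows "expands (nat (T_pq p q (int n + 1) - 1)) (u @ [remainder (int n + 1) + (p - q)])"
proof -
  have "int (q * nat (T_pq p q (int n + 1) - 1)) = int q * T_pq p q (int n + 1) - int q"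
    using T_pos[of "int n + 1"] by (simp add: right_diff_distrib)
  also have "\<dots> = int (p * n + (remainder (int n + 1) + (p - q)))"
    using q_less_p unfolding q_times_T by (simp add: algebra_simps of_nat_diff)
  finally have "q * nat (T_pq p q (int n + 1) - 1) = p * n + (remainder (int n + 1) + (p - q))"
    by (simp only: of_nat_eq_iff)
  moreover have "remainder (int n + 1) + (p - q) < p" "remainder (int n + 1) + (p - q) \<noteq> 0"
    using remainder_less[of "int n + 1"] q_less_p by linarith+
  ultimately show ?thesis
    using assms unfolding expands_snoc by blast
qed

text \<open>
  The digits that may follow \<open>n\<close> all lie in the residue class of \<open>- p n\<close> modulo \<open>q\<close>. The two bounds
  below are its extreme members in \<open>{0..<p}\<close>: the second one is congruent to
  \<open>- p (n + 1) + p\<close> and at least \<open>p - q\<close>.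
\<close>

lemma remainder_le_digit:
  assumes "q dvd p * n + a"
  shows "remainder (int n) \<le> a"
proof -
  have "[int a = - (int p * int n)] (mod int q)"
    using assms by (simp add: cong_iff_dvd_diff add.commute flip: of_nat_mult of_nat_add)
  then have "remainder (int n) = a mod q"
    by (simp add: remainder_def cong_def nat_mod_as_int)
  then show ?thesis
    by simp
qed

lemma digit_le_remainder:
  assumes "q dvd p * n + a" "a < p"
  shows "a \<le> remainder (int n + 1) + (p - q)"
proof (rule ccontr)
  let ?b = "remainder (int n + 1) + (p - q)"
  assume "\<not> a \<le> ?b"
  have "int q dvd (int p * int n + int a) - (int q * T_pq p q (int n + 1) - int q)"
    using assms(1) by (intro dvd_diff) (simp_all flip: of_nat_mult of_nat_add)
  moreover have "(int p * int n + int a) - (int q * T_pq p q (int n + 1) - int q) = int (a - ?b)"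
    using \<open>\<not> a \<le> ?b\<close> q_less_p unfolding q_times_T by (simp add: algebra_simps of_nat_diff)
  ultimately have "q dvd a - ?b"
    by simp
  moreover have "0 < a - ?b" "a - ?b < q"
    using \<open>\<not> a \<le> ?b\<close> assms(2) q_less_p by auto
  ultimately show False
    by (simp add: nat_dvd_not_less)
qed

text \<open>
  Greedy choice is lexicographically optimal: the language is prefix-closed, so the first letter of
  any extension is itself a possible next digit, and no greedy step runs into a dead end.
\<close>

lemma lex_smallest_remainders:
  assumes "expands n u" "1 \<le> n"
  shows "lex_smallest (right_extensions p q u l) (prefix l (remainders (int n)))"
  using assms
proof (induction l arbitrary: n u)
  case 0
  then show ?case
    by (auto simp: lex_smallest_def right_extensions_def lang_iff)
next
  case (Suc l)
  define n' where "n' = nat (T_pq p q (int n))"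
  let ?b = "remainder (int n)"
  have n': "1 \<le> n'" "T_pq p q (int n) = int n'"
    using T_pos[of "int n"] Suc.prems(2) by (auto simp: n'_def)
  have "expands n' (u @ [?b])"
    using expands_snoc_min Suc.prems by (simp add: n'_def)
  from Suc.IH[OF this n'(1)]
  have IH: "lex_smallest (right_extensions p q (u @ [?b]) l) (prefix l (remainders (int n')))" .
  show ?case
    unfolding lex_smallest_def prefix_remainders_Suc n'(2)
  proof (intro conjI ballI)
    show "?b # prefix l (remainders (int n')) \<in> right_extensions p q u (Suc l)"
      using IH remainder_less[of "int n"] q_less_p
      by (auto simp: right_extensions_Cons lex_smallest_def)
  next
    fix v'
    assume v': "v' \<in> right_extensions p q u (Suc l)"
    then obtain a v where v'_eq: "v' = a # v"
      by (cases v') (auto simp: right_extensions_def)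
    have v: "v \<in> right_extensions p q (u @ [a]) l"
      using v' unfolding v'_eq right_extensions_Cons by simp
    then have "u @ [a] \<in> lang_pq p q"
      using lang_prefix_closed by (auto simp: right_extensions_def simp del: append_assoc)
    then have "?b \<le> a"
      using snoc_in_langD Suc.prems(1) remainder_le_digit by blast
    then show "lexordp_eq (?b # prefix l (remainders (int n'))) v'"
      using IH v unfolding v'_eq lex_smallest_def by (auto simp: le_less)
  qed
qed

lemma lex_largest_remainders:
  assumes "expands n u"
  shows "lex_largest (right_extensions p q u l)
           (prefix l ((\<lambda>d. d + (p - q)) \<circ> remainders (int n + 1)))"
  using assms
proof (induction l arbitrary: n u)
  case 0
  then show ?case
    by (auto simp: lex_largest_def right_extensions_def lang_iff)
next
  case (Suc l)
  define n' where "n' = nat (T_pq p q (int n + 1) - 1)"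
  let ?shift = "\<lambda>d. d + (p - q)"
  let ?b = "remainder (int n + 1) + (p - q)"
  have n': "T_pq p q (int n + 1) = int n' + 1"
    using T_pos[of "int n + 1"] by (auto simp: n'_def)
  have "expands n' (u @ [?b])"
    using expands_snoc_max Suc.prems by (simp add: n'_def)
  from Suc.IH[OF this]
  have IH: "lex_largest (right_extensions p q (u @ [?b]) l)
      (prefix l (?shift \<circ> remainders (int n' + 1)))" .
  have prefix_eq: "prefix (Suc l) (?shift \<circ> remainders (int n + 1))
      = ?b # prefix l (?shift \<circ> remainders (int n' + 1))"
    unfolding prefix_Suc_Cons n'[symmetric] remainders_Suc[symmetric]
    by (simp add: remainders_0 comp_def)
  show ?case
    unfolding lex_largest_def prefix_eq
  proof (intro conjI ballI)
    show "?b # prefix l (?shift \<circ> remainders (int n' + 1)) \<in> right_extensions p q u (Suc l)"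
      using IH remainder_less[of "int n + 1"] q_less_p
      by (auto simp: right_extensions_Cons lex_largest_def)
  next
    fix v'
    assume v': "v' \<in> right_extensions p q u (Suc l)"
    then obtain a v where v'_eq: "v' = a # v"
      by (cases v') (auto simp: right_extensions_def)
    have v: "v \<in> right_extensions p q (u @ [a]) l"
      using v' unfolding v'_eq right_extensions_Cons by simp
    then have "u @ [a] \<in> lang_pq p q"
      using lang_prefix_closed by (auto simp: right_extensions_def simp del: append_assoc)
    then have "a \<le> ?b"
      using snoc_in_langD Suc.prems(1) digit_le_remainder by blast
    then show "lexordp_eq v' (?b # prefix l (?shift \<circ> remainders (int n' + 1)))"
      using IH v unfolding v'_eq lex_largest_def by (auto simp: le_less)
  qed
qed

lemma wmin_eq:
  assumes "expands n u" "1 \<le> n"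
  shows "wmin_pq p q u = remainders (int n)"
  unfolding wmin_pq_def using lex_smallest_remainders[OF assms] by (rule The_lex_smallest_prefix)

lemma wmax_eq:
  assumes "expands n u"
  shows "wmax_pq p q u = (\<lambda>d. d + (p - q)) \<circ> remainders (int n + 1)"
  unfolding wmax_pq_def using lex_largest_remainders[OF assms] by (rule The_lex_largest_prefix)

section \<open>Normality and equidistribution\<close>

theorem normal_extreme_words_iff_equidistributed:
  "(\<forall>u \<in> lang_pq p q. normal_word {p - q..p - 1} (wmax_pq p q u)) \<and>
   (\<forall>u \<in> lang_pq p q. u \<noteq> [] \<longrightarrow> normal_word {0..q - 1} (wmin_pq p q u))
   \<longleftrightarrow> (\<forall>n::int. n \<ge> 1 \<longrightarrow> (\<forall>k. equidistributed_mod (\<lambda>l. (T_pq p q ^^ l) n) (q ^ k)))"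
  (is "?max \<and> ?min \<longleftrightarrow> ?equi")
proof (intro iffI conjI)
  assume "?max \<and> ?min"
  show ?equi
  proof (intro allI impI)
    fix n :: int and k
    assume "n \<ge> 1"
    obtain u where u: "expands (nat n) u"
      using expands_exists by blast
    have "u \<noteq> []"
      using u \<open>n \<ge> 1\<close> by (auto simp: expands_Nil)
    then have "normal_word {0..q - 1} (wmin_pq p q u)"
      using \<open>?max \<and> ?min\<close> u lang_iff by blast
    then have "normal_word {0..q - 1} (remainders n)"
      using wmin_eq[OF u] \<open>n \<ge> 1\<close> by simp
    then show "equidistributed_mod (\<lambda>l. (T_pq p q ^^ l) n) (q ^ k)"
      using normal_remainders_iff by blast
  qed
next
  assume ?equi
  then have normal: "normal_word {0..q - 1} (remainders n)" if "n \<ge> 1" for n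
    using that normal_remainders_iff by blast
  show ?min
  proof (intro ballI impI)
    fix u
    assume "u \<in> lang_pq p q" "u \<noteq> []"
    then obtain n where n: "expands n u"
      using lang_iff by blast
    then have "1 \<le> n"
      using \<open>u \<noteq> []\<close> expands_0D by (cases n) auto
    then show "normal_word {0..q - 1} (wmin_pq p q u)"
      using normal wmin_eq[OF n] by simp
  qed
  show ?max
  proof
    fix u
    assume "u \<in> lang_pq p q"
    then obtain n where n: "expands n u"
      using lang_iff by blast
    have "(\<lambda>d. d + (p - q)) ` {0..q - 1} = {p - q..p - 1}"
      using q_pos q_less_p
      by (subst image_add_atLeastAtMost') (intro arg_cong2[of _ _ _ _ atLeastAtMost]; linarith)
    then show "normal_word {p - q..p - 1} (wmax_pq p q u)"
      using normal_word_relabel[OF normal[of "int n + 1"], of "\<lambda>d. d + (p - q)"] wmax_eq[OF n]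
      by (simp add: inj_def)
  qed
qed

end

theorem theorem1p7:
  shows "(\<forall>p q :: nat. p > q \<and> q \<ge> 1 \<and> coprime p q \<longrightarrow>
            (\<forall>u \<in> lang_pq p q. normal_word {p - q..p - 1} (wmax_pq p q u)) \<and>
            (\<forall>u \<in> lang_pq p q. u \<noteq> [] \<longrightarrow> normal_word {0..q - 1} (wmin_pq p q u)))
     \<longleftrightarrow>
         (\<forall>p q :: nat. p > q \<and> q \<ge> 1 \<and> coprime p q \<longrightarrow>
            (\<forall>n::int. n \<ge> 1 \<longrightarrow>
              (\<forall>k::nat. equidistributed_mod (\<lambda>l. (T_pq p q ^^ l) n) (q ^ k))))"
proof -
  have "rational_base p q" if "p > q \<and> q \<ge> 1 \<and> coprime p q" for p q
    using that by unfold_locales auto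
  note iff = rational_base.normal_extreme_words_iff_equidistributed[OF this]
  show ?thesis
    using iff by meson
qed

end
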